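(* If $\{H_j\}_{j \in J}$ is a collection of bounded torsion groups for which $\{\operatorname{ex}(H_j)\}_{j \in J}$ is unbounded in $\omega$, then the direct sum $\bigoplus_{j \in J} H_j$ is not a homomorphic image of any ultraproduct $(\prod_{i\in\omega} G_i)/\mathcal{U}$ with $\mathcal{U}$ a nonprincipal ultrafilter on $\omega$ and $(G_i)_{i\in\omega}$ a sequence of groups.
   Context: Groups are not assumed abelian. $\omega$ is the set of natural numbers. A group $H$ is a bounded torsion group if there is a positive integer $n$ with $h^n = 1_H$ for all $h\in H$; $\operatorname{ex}(H)$ denotes the smallest such $n$. $\bigoplus_{j\in J} H_j$ is the subgroup of $\prod_{j\in J} H_j$ of elements that are trivial in all but finitely many coordinates. The ultraproduct $(\prod_{i\in\omega} G_i)/\mathcal{U}$ is the quotient of $\prod_{i\in\omega} G_i$ by the normal subgroup of all $(g_i)_{i\in\omega}$ with $\{i : g_i = 1_{G_i}\}\in\mathcal{U}$. "Homomorphic image" means image under a surjective group homomorphism. *)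

theory Defs
  imports "HOL-Algebra.Algebra"
begin

definition bounded_torsion_group :: "('a, 'b) monoid_scheme \<Rightarrow> bool" where
  "bounded_torsion_group H \<longleftrightarrow>
     group H \<and> (\<exists>n::nat. n > 0 \<and> (\<forall>h\<in>carrier H. h [^]\<^bsub>H\<^esub> n = \<one>\<^bsub>H\<^esub>))"

text \<open>The value is unspecified unless \<^term>\<open>H\<close> is a bounded torsion group.\<close>

definition group_exponent :: "('a, 'b) monoid_scheme \<Rightarrow> nat" where
  "group_exponent H = (LEAST n. n > 0 \<and> (\<forall>h\<in>carrier H. h [^]\<^bsub>H\<^esub> n = \<one>\<^bsub>H\<^esub>))"

text \<open>
  A set \<open>A\<close> belongs to the filter \<open>U\<close> iff \<open>eventually (\<lambda>i. i \<in> A) U\<close>. Values of type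
  \<open>'i filter\<close> may be improper (\<^term>\<open>bot\<close> contains the empty set), so properness is
  part of the definition.
\<close>

definition ultrafilter :: "'i filter \<Rightarrow> bool" where
  "ultrafilter U \<longleftrightarrow> U \<noteq> bot \<and> (\<forall>P. eventually P U \<or> eventually (\<lambda>i. \<not> P i) U)"

definition nonprincipal :: "'i filter \<Rightarrow> bool" where
  "nonprincipal U \<longleftrightarrow> (\<forall>S. U \<noteq> principal S)"

definition ultraproduct_kernel ::
    "'i filter \<Rightarrow> ('i \<Rightarrow> ('a, 'b) monoid_scheme) \<Rightarrow> ('i \<Rightarrow> 'a) set" where
  "ultraproduct_kernel U G =
     {g \<in> carrier (product_group UNIV G). eventually (\<lambda>i. g i = \<one>\<^bsub>G i\<^esub>) U}"

definition ultraproduct ::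
    "'i filter \<Rightarrow> ('i \<Rightarrow> ('a, 'b) monoid_scheme) \<Rightarrow> ('i \<Rightarrow> 'a) set monoid" where
  "ultraproduct U G = product_group UNIV G Mod ultraproduct_kernel U G"

lemma normal_ultraproduct_kernel:
  assumes G: "\<And>i. group (G i)"
  shows "ultraproduct_kernel U G \<lhd> product_group UNIV G"
proof -
  note group.is_monoid [OF G, simp]
  interpret P: group "product_group UNIV G" by (simp add: G)
  have "subgroup (ultraproduct_kernel U G) (product_group UNIV G)"
  proof (rule P.subgroupI)
    show "ultraproduct_kernel U G \<subseteq> carrier (product_group UNIV G)"
      by (auto simp: ultraproduct_kernel_def)
    have "\<one>\<^bsub>product_group UNIV G\<^esub> \<in> ultraproduct_kernel U G"
      by (simp add: ultraproduct_kernel_def)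
    then show "ultraproduct_kernel U G \<noteq> {}" by blast
  next
    fix a assume a: "a \<in> ultraproduct_kernel U G"
    then have "eventually (\<lambda>i. inv\<^bsub>G i\<^esub> a i = \<one>\<^bsub>G i\<^esub>) U"
      by (auto simp: ultraproduct_kernel_def monoid.inv_one elim!: eventually_mono)
    with a show "inv\<^bsub>product_group UNIV G\<^esub> a \<in> ultraproduct_kernel U G"
      by (auto simp: ultraproduct_kernel_def G PiE_iff group.inv_closed)
  next
    fix a b assume ab: "a \<in> ultraproduct_kernel U G" "b \<in> ultraproduct_kernel U G"
    then have "eventually (\<lambda>i. a i = \<one>\<^bsub>G i\<^esub> \<and> b i = \<one>\<^bsub>G i\<^esub>) U"
      by (auto simp: ultraproduct_kernel_def eventually_conj)
    then have "eventually (\<lambda>i. a i \<otimes>\<^bsub>G i\<^esub> b i = \<one>\<^bsub>G i\<^esub>) U"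
      by (rule eventually_mono) simp
    with ab show "a \<otimes>\<^bsub>product_group UNIV G\<^esub> b \<in> ultraproduct_kernel U G"
      by (auto simp: ultraproduct_kernel_def PiE_iff monoid.m_closed)
  qed
  moreover have "x \<otimes>\<^bsub>product_group UNIV G\<^esub> a \<otimes>\<^bsub>product_group UNIV G\<^esub>
      inv\<^bsub>product_group UNIV G\<^esub> x \<in> ultraproduct_kernel U G"
    if x: "x \<in> carrier (product_group UNIV G)" and a: "a \<in> ultraproduct_kernel U G" for x a
  proof -
    have "eventually (\<lambda>i. x i \<otimes>\<^bsub>G i\<^esub> a i \<otimes>\<^bsub>G i\<^esub> inv\<^bsub>G i\<^esub> x i = \<one>\<^bsub>G i\<^esub>) U"
      using a x by (auto simp: ultraproduct_kernel_def PiE_iff G group.r_inv elim!: eventually_mono)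
    with a x show ?thesis
      by (auto simp: ultraproduct_kernel_def G PiE_iff group.inv_closed monoid.m_closed)
  qed
  ultimately show ?thesis by (simp only: P.normal_inv_iff) blast
qed

lemma group_ultraproduct: "group (ultraproduct U G)" if "\<And>i. group (G i)"
  unfolding ultraproduct_def
  by (intro normal.factorgroup_is_group normal_ultraproduct_kernel that)

end

theory Submission
  imports Defs
begin

text \<open>
  A homomorphism from the ultraproduct is evaluated on an infinite nested product
  \<open>x\<^sub>0 = g\<^sub>0 (g\<^sub>1 (g\<^sub>2 (\<dots>)\<^bsup>e\<^sub>2\<^esup>)\<^bsup>e\<^sub>1\<^esup>)\<^bsup>e\<^sub>0\<^esup>\<close>, which makes sense coordinatewise because
  \<open>g\<^sub>k\<close> may be taken trivial in the coordinates \<open>i < k\<close>. Choose indices \<open>j\<^sub>k\<close> whose exponents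
  \<open>e\<^sub>k = ex(H\<^bsub>j\<^sub>k\<^esub>)\<close> satisfy \<open>e\<^sub>k > N\<^sub>k = e\<^sub>0 \<cdots> e\<^bsub>k-1\<^esub>\<close>, and let \<open>g\<^sub>k\<close> map to an element
  supported at \<open>j\<^sub>k\<close> with value \<open>a\<^sub>k\<close>, where \<open>a\<^sub>k\<close> to the power \<open>N\<^sub>k\<close> is nontrivial. Since
  \<open>e\<^sub>k\<close> kills \<open>H\<^bsub>j\<^sub>k\<^esub>\<close>, the image of \<open>x\<^sub>0\<close> at \<open>j\<^sub>k\<close> is exactly that power, for every \<open>k\<close>, so
  the image has infinite support.
\<close>

lemma group_exponent_properties:
  assumes "bounded_torsion_group H"
  shows group_exponent_pos: "0 < group_exponent H"
    and pow_group_exponent: "h \<in> carrier H \<Longrightarrow> h [^]\<^bsub>H\<^esub> group_exponent H = \<one>\<^bsub>H\<^esub>"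
proof -
  have "\<exists>n::nat. n > 0 \<and> (\<forall>h\<in>carrier H. h [^]\<^bsub>H\<^esub> n = \<one>\<^bsub>H\<^esub>)"
    using assms by (auto simp: bounded_torsion_group_def)
  from LeastI_ex [OF this] show "0 < group_exponent H"
    and "h \<in> carrier H \<Longrightarrow> h [^]\<^bsub>H\<^esub> group_exponent H = \<one>\<^bsub>H\<^esub>"
    by (auto simp: group_exponent_def)
qed

lemma ex_pow_neq_one:
  assumes "0 < n" "n < group_exponent H"
  shows "\<exists>h\<in>carrier H. h [^]\<^bsub>H\<^esub> n \<noteq> \<one>\<^bsub>H\<^esub>"
  using not_less_Least [OF assms(2) [unfolded group_exponent_def]] assms(1) by blast

text \<open>If the complement of \<open>{n}\<close> were not in \<open>U\<close>, then
  \<open>{n}\<close> would be, and membership in \<open>U\<close> would be decided at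
  \<open>n\<close> alone, making \<open>U\<close> principal. Intersecting finitely many such
  complements gives the claim; it is what allows any finite set of initial coordinates to be
  ignored.\<close>

lemma eventually_ge_nonprincipal:
  assumes "ultrafilter U" "nonprincipal U"
  shows "eventually (\<lambda>i::nat. k \<le> i) U"
proof -
  have neq: "eventually (\<lambda>i. i \<noteq> n) U" for n
  proof (rule ccontr)
    assume "\<not> eventually (\<lambda>i. i \<noteq> n) U"
    with assms(1) have ev: "eventually (\<lambda>i. i = n) U"
      unfolding ultrafilter_def by blast
    have "eventually P U \<longleftrightarrow> P n" for P
    proof
      assume "eventually P U"
      with ev have "eventually (\<lambda>i. P n) U"
        by eventually_elim simp
      with assms(1) show "P n"
        by (auto simp: ultrafilter_def eventually_const_iff)
    next
      assume "P n"
      with ev show "eventually P U"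
        by (auto elim: eventually_mono)
    qed
    then have "U = principal {n}"
      by (simp add: filter_eq_iff eventually_principal)
    with assms(2) show False
      by (simp add: nonprincipal_def)
  qed
  have "eventually (\<lambda>i. \<forall>n\<in>{..<k}. i \<noteq> n) U"
    by (rule eventually_ball_finite) (use neq in auto)
  then show ?thesis
    by (rule eventually_mono) (auto simp: not_less [symmetric])
qed

text \<open>From index \<open>n\<close> on all factors are trivial, so the constant sequence
  \<open>\<one>\<close> solves the recursion there, and earlier terms are then computed backwards.
  The induction drops the first factor, hence \<open>g\<close> and \<open>e\<close> are
  generalized.\<close>

lemma (in group) nested_product_exists:
  assumes "\<And>k. g k \<in> carrier G" "\<And>k. n \<le> k \<Longrightarrow> g k = \<one>"
  shows "\<exists>x. \<forall>k. x k \<in> carrier G \<and> x k = g k \<otimes> x (Suc k) [^] (e k :: nat)"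
  using assms
proof (induction n arbitrary: g e)
  case 0
  then show ?case
    by (intro exI [of _ "\<lambda>_. \<one>"]) simp
next
  case (Suc n)
  have "\<exists>x. \<forall>k. x k \<in> carrier G \<and> x k = g (Suc k) \<otimes> x (Suc k) [^] e (Suc k)"
    by (rule Suc.IH) (use Suc.prems in auto)
  then obtain x where x: "\<And>k. x k \<in> carrier G"
    "\<And>k. x k = g (Suc k) \<otimes> x (Suc k) [^] e (Suc k)"
    by metis
  show ?case
  proof (intro exI allI)
    fix k
    \<comment> \<open>The solution \<open>x\<close> for the shifted data is moved up by one place,
      and the head is forced by the recursion at index 0.\<close>
    show "case_nat (g 0 \<otimes> x 0 [^] e 0) x k \<in> carrier G \<and>
      case_nat (g 0 \<otimes> x 0 [^] e 0) x k =
        g k \<otimes> case_nat (g 0 \<otimes> x 0 [^] e 0) x (Suc k) [^] e k"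
      using x(1) Suc.prems(1) by (cases k) (auto simp flip: x(2))
  qed
qed

lemma hom_product_group_component:
  assumes "i \<in> I"
  shows "(\<lambda>x. x i) \<in> hom (product_group I G) (G i)"
  using assms by (auto simp: hom_def)

lemma hom_sum_group_component:
  assumes "\<And>i. i \<in> I \<Longrightarrow> group (G i)" "i \<in> I"
  shows "(\<lambda>x. x i) \<in> hom (sum_group I G) (G i)"
  using assms by (auto simp: hom_def carrier_sum_group)

text \<open>At coordinate \<open>i\<close> only the factors \<open>g 0\<close>, ...,
  \<open>g i\<close> can be nontrivial, so the nested product terminates there (with bound
  \<open>Suc i\<close>), although no single bound serves all coordinates.\<close>

lemma product_group_nested_product:
  assumes G: "\<And>i. group (G i)"
    and g: "\<And>k. g k \<in> carrier (product_group UNIV G)"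
    and triv: "\<And>k i. i < k \<Longrightarrow> g k i = \<one>\<^bsub>G i\<^esub>"
  obtains x where "\<And>k::nat. x k \<in> carrier (product_group UNIV G)"
    and "\<And>k. x k = g k \<otimes>\<^bsub>product_group UNIV G\<^esub>
                    x (Suc k) [^]\<^bsub>product_group UNIV G\<^esub> (e k :: nat)"
proof -
  have P: "group (product_group UNIV G)"
    by (simp add: G)
  have "\<forall>i. \<exists>x. \<forall>k. x k \<in> carrier (G i) \<and> x k = g k i \<otimes>\<^bsub>G i\<^esub> x (Suc k) [^]\<^bsub>G i\<^esub> e k"
  proof
    fix i
    show "\<exists>x. \<forall>k. x k \<in> carrier (G i) \<and> x k = g k i \<otimes>\<^bsub>G i\<^esub> x (Suc k) [^]\<^bsub>G i\<^esub> e k"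
      by (rule group.nested_product_exists [OF G, where n = "Suc i"]) (use g triv in auto)
  qed
  then obtain x where x: "\<And>i k. x i k \<in> carrier (G i)"
    "\<And>i k. x i k = g k i \<otimes>\<^bsub>G i\<^esub> x i (Suc k) [^]\<^bsub>G i\<^esub> e k"
    by metis
  show thesis
  proof
    fix k
    have mem: "(\<lambda>i. x i k) \<in> carrier (product_group UNIV G)" for k
      using x(1) by auto
    then show "(\<lambda>i. x i k) \<in> carrier (product_group UNIV G)" .
    have "((\<lambda>i. x i (Suc k)) [^]\<^bsub>product_group UNIV G\<^esub> e k) i = x i (Suc k) [^]\<^bsub>G i\<^esub> e k" for i
      using hom_nat_pow [OF hom_product_group_component mem P G] by simp
    then show "(\<lambda>i. x i k) = g k \<otimes>\<^bsub>product_group UNIV G\<^esub>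
        (\<lambda>i. x i (Suc k)) [^]\<^bsub>product_group UNIV G\<^esub> e k"
      by (simp add: fun_eq_iff x(2) [symmetric])
  qed
qed

lemma ultraproduct_kernel_coset_eq:
  assumes G: "\<And>i. group (G i)"
    and x: "x \<in> carrier (product_group UNIV G)" and y: "y \<in> carrier (product_group UNIV G)"
    and ev: "eventually (\<lambda>i. x i = y i) U"
  shows "ultraproduct_kernel U G #>\<^bsub>product_group UNIV G\<^esub> x =
         ultraproduct_kernel U G #>\<^bsub>product_group UNIV G\<^esub> y"
proof -
  interpret N: normal "ultraproduct_kernel U G" "product_group UNIV G"
    by (rule normal_ultraproduct_kernel [OF G])
  have "eventually (\<lambda>i. y i \<otimes>\<^bsub>G i\<^esub> inv\<^bsub>G i\<^esub> x i = \<one>\<^bsub>G i\<^esub>) U"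
    using ev by (rule eventually_mono) (use y G in \<open>auto simp: group.r_inv PiE_iff\<close>)
  then have "y \<otimes>\<^bsub>product_group UNIV G\<^esub> inv\<^bsub>product_group UNIV G\<^esub> x \<in> ultraproduct_kernel U G"
    using x y G by (auto simp: ultraproduct_kernel_def PiE_iff group.inv_closed monoid.m_closed
        group.is_monoid)
  then have "y \<in> ultraproduct_kernel U G #>\<^bsub>product_group UNIV G\<^esub> x"
    using x y by (intro N.rcos_module_rev) (simp_all add: N.is_group)
  then show ?thesis
    by (rule N.repr_independence) (use x N.subgroup_axioms in auto)
qed

lemma unbounded_imp_dominating_sequence:
  fixes e :: "'a \<Rightarrow> nat"
  assumes "\<not> bdd_above (e ` J)"
  shows "\<exists>s. \<forall>k::nat. s k \<in> J \<and> (\<Prod>l<k. e (s l)) < e (s k)"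
\<comment> \<open>The bound on \<open>s k\<close> involves only earlier values of \<open>s\<close>,
  so unboundedness supplies each next index.\<close>
proof (rule dependent_wellorder_choice)
  fix k :: nat and s :: "nat \<Rightarrow> 'a"
  show "\<exists>j. j \<in> J \<and> (\<Prod>l<k. e (s l)) < e j"
    using assms by (auto simp: bdd_above_def not_le)
qed auto

theorem corollary23:
  fixes J :: "'j set" and H :: "'j \<Rightarrow> ('h, 'm) monoid_scheme"
    and G :: "nat \<Rightarrow> ('g, 'n) monoid_scheme" and U :: "nat filter"
  assumes "\<And>j. j \<in> J \<Longrightarrow> bounded_torsion_group (H j)"
    and "\<not> bdd_above ((\<lambda>j. group_exponent (H j)) ` J)"
    and "\<And>i. group (G i)"
    and "ultrafilter U" and "nonprincipal U"
  shows "\<not> (\<exists>f. f \<in> epi (ultraproduct U G) (sum_group J H))"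
proof
  assume "\<exists>f. f \<in> epi (ultraproduct U G) (sum_group J H)"
  then obtain f where fhom: "f \<in> hom (ultraproduct U G) (sum_group J H)"
    and fsurj: "f ` carrier (ultraproduct U G) = carrier (sum_group J H)"
    by (auto simp: epi_def)
  let ?P = "product_group UNIV G"
  have P: "group ?P"
    by (simp add: assms(3))
  have H: "group (H j)" if "j \<in> J" for j
    using assms(1) [OF that] by (simp add: bounded_torsion_group_def)
  obtain s where s:
    "\<forall>k::nat. s k \<in> J \<and> (\<Prod>l<k. group_exponent (H (s l))) < group_exponent (H (s k))"
    using unbounded_imp_dominating_sequence [OF assms(2)] by blast
  then have sJ: "s k \<in> J" for k
    by blast
  define e where "e k = group_exponent (H (s k))" for k
  have epos: "0 < e k" for k
    using group_exponent_pos [OF assms(1) [OF sJ]] by (simp add: e_def)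
  have e: "(\<Prod>l<k. e l) < e k" for k
    using s by (simp add: e_def)
  \<comment> \<open>Growth of \<open>e\<close> serves to make \<open>s\<close> injective:
    \<open>e k\<close> depends only on \<open>s k\<close>, so distinct exponents force distinct
    indices.\<close>
  have "e k < e (Suc k)" for k
  proof -
    have "1 * e k \<le> (\<Prod>l<k. e l) * e k"
      using epos by (intro mult_right_mono) (auto simp: Suc_le_eq prod_pos)
    also have "\<dots> < e (Suc k)"
      using e [of "Suc k"] by (simp add: mult.commute)
    finally show ?thesis by simp
  qed
  then have "strict_mono e"
    by (simp add: strict_mono_Suc_iff)
  then have "inj e"
    by (rule strict_mono_imp_inj_on)
  then have inj: "inj s"
    unfolding e_def inj_def by metis

  \<comment> \<open>The product is positive and smaller than the exponent \<open>e k\<close>, so by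
    minimality of the latter it cannot kill all of \<open>H (s k)\<close>.\<close>
  have "\<exists>a\<in>carrier (H (s k)). a [^]\<^bsub>H (s k)\<^esub> (\<Prod>l<k. e l) \<noteq> \<one>\<^bsub>H (s k)\<^esub>" for k
    by (rule ex_pow_neq_one) (use e epos in \<open>auto simp: prod_pos e_def [symmetric]\<close>)
  then obtain a where a: "\<And>k. a k \<in> carrier (H (s k))"
    and a_pow: "\<And>k. a k [^]\<^bsub>H (s k)\<^esub> (\<Prod>l<k. e l) \<noteq> \<one>\<^bsub>H (s k)\<^esub>"
    by metis

  \<comment> \<open>Composing \<open>f\<close> with the quotient map moves the computation to the
    full product, where the nested product lives.\<close>
  define q where "q x = f (ultraproduct_kernel U G #>\<^bsub>?P\<^esub> x)" for x
  have "q \<in> hom ?P (sum_group J H)"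
    using hom_compose [OF normal.r_coset_hom_Mod [OF normal_ultraproduct_kernel [OF assms(3)]]
        fhom [unfolded ultraproduct_def]]
    by (simp add: q_def [abs_def] o_def)
  then have qj: "(\<lambda>x. q x j) \<in> hom ?P (H j)" if "j \<in> J" for j
    using hom_compose [OF _ hom_sum_group_component [of J H j], of q ?P] H that
    by (auto simp: o_def)

  have "\<exists>g. g \<in> carrier ?P \<and> (\<forall>i<k. g i = \<one>\<^bsub>G i\<^esub>) \<and>
         q g = (\<lambda>j\<in>J. if j = s k then a k else \<one>\<^bsub>H j\<^esub>)" for k
  proof -
    have "finite {j \<in> J. (\<lambda>j\<in>J. if j = s k then a k else \<one>\<^bsub>H j\<^esub>) j \<noteq> \<one>\<^bsub>H j\<^esub>}"
      by (rule finite_subset [of _ "{s k}"]) auto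
    then have "(\<lambda>j\<in>J. if j = s k then a k else \<one>\<^bsub>H j\<^esub>) \<in> carrier (sum_group J H)"
      using a H by (auto simp: carrier_sum_group group.is_monoid)
    then obtain g where g: "g \<in> carrier ?P"
      and qg: "q g = (\<lambda>j\<in>J. if j = s k then a k else \<one>\<^bsub>H j\<^esub>)"
      unfolding fsurj [symmetric] q_def ultraproduct_def carrier_FactGroup by auto
    \<comment> \<open>Overwriting the first \<open>k\<close> coordinates of the preimage leaves its
      coset unchanged, because \<open>U\<close> contains the set of all \<open>i\<close> with
      \<open>k \<le> i\<close>.\<close>
    define g' where "g' i = (if i < k then \<one>\<^bsub>G i\<^esub> else g i)" for i
    have g': "g' \<in> carrier ?P"
      using g assms(3) by (auto simp: g'_def group.is_monoid)
    have "eventually (\<lambda>i. g' i = g i) U"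
      using eventually_ge_nonprincipal [OF assms(4,5), of k]
      by (rule eventually_mono) (auto simp: g'_def)
    from ultraproduct_kernel_coset_eq [OF assms(3) g' g this]
    have "q g' = q g"
      by (simp add: q_def)
    with g' qg show ?thesis
      by (intro exI [of _ g']) (auto simp: g'_def)
  qed
  then obtain g where g: "\<And>k. g k \<in> carrier ?P" "\<And>k i. i < k \<Longrightarrow> g k i = \<one>\<^bsub>G i\<^esub>"
    and qg: "\<And>k. q (g k) = (\<lambda>j\<in>J. if j = s k then a k else \<one>\<^bsub>H j\<^esub>)"
    by metis
  obtain x where x: "\<And>k. x k \<in> carrier ?P"
    and x_rec: "\<And>k. x k = g k \<otimes>\<^bsub>?P\<^esub> x (Suc k) [^]\<^bsub>?P\<^esub> e k"
    using product_group_nested_product [of G g e] assms(3) g by blast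

  have q_rec: "q (x k) j = q (g k) j \<otimes>\<^bsub>H j\<^esub> q (x (Suc k)) j [^]\<^bsub>H j\<^esub> e k" if "j \<in> J" for k j
  proof -
    have "q (x k) j = q (g k \<otimes>\<^bsub>?P\<^esub> x (Suc k) [^]\<^bsub>?P\<^esub> e k) j"
      by (subst x_rec) (rule refl)
    also have "\<dots> = q (g k) j \<otimes>\<^bsub>H j\<^esub> q (x (Suc k) [^]\<^bsub>?P\<^esub> e k) j"
      using hom_mult [OF qj [OF that] g(1) monoid.nat_pow_closed [OF group.is_monoid [OF P] x]] .
    also have "q (x (Suc k) [^]\<^bsub>?P\<^esub> e k) j = q (x (Suc k)) j [^]\<^bsub>H j\<^esub> e k"
      using hom_nat_pow [OF qj [OF that] x P H [OF that]] .
    finally show ?thesis .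
  qed
  \<comment> \<open>Downward induction from \<open>k = l\<close>. At \<open>l\<close> the unknown
    tail is raised to the power \<open>e l\<close> and vanishes, leaving \<open>a l\<close> (empty
    product). For \<open>k < l\<close> the factor \<open>g k\<close> contributes nothing at
    \<open>s l\<close>, by injectivity of \<open>s\<close>, and the exponent gains the factor
    \<open>e k\<close>.\<close>
  have "q (x k) (s l) = a l [^]\<^bsub>H (s l)\<^esub> (\<Prod>i=k..<l. e i)" if "k \<le> l" for k l
    using that
  proof (induction rule: inc_induct)
    case base
    interpret Hl: group "H (s l)" by (rule H [OF sJ])
    have "q (x (Suc l)) (s l) \<in> carrier (H (s l))"
      using hom_in_carrier [OF qj [OF sJ] x] .
    then have "q (x (Suc l)) (s l) [^]\<^bsub>H (s l)\<^esub> e l = \<one>\<^bsub>H (s l)\<^esub>"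
      unfolding e_def by (rule pow_group_exponent [OF assms(1) [OF sJ]])
    with a sJ show ?case
      by (subst q_rec) (simp_all add: qg)
  next
    case (step k)
    interpret Hl: group "H (s l)" by (rule H [OF sJ])
    have "s l \<noteq> s k"
      using step.hyps inj by (auto dest: injD)
    with a sJ step show ?case
      by (subst q_rec) (simp_all add: qg Hl.nat_pow_pow prod.atLeast_Suc_lessThan mult.commute)
  qed
  \<comment> \<open>For \<open>k = 0\<close> the exponent is exactly the product that
    \<open>a l\<close> was chosen to survive, so the support of \<open>q (x 0)\<close> contains the
    infinite range of \<open>s\<close>.\<close>
  then have "q (x 0) (s l) \<noteq> \<one>\<^bsub>H (s l)\<^esub>" for l
    using a_pow by (simp add: atLeast0LessThan)
  then have "range s \<subseteq> {j \<in> J. q (x 0) j \<noteq> \<one>\<^bsub>H j\<^esub>}"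
    using sJ by auto
  moreover have "finite {j \<in> J. q (x 0) j \<noteq> \<one>\<^bsub>H j\<^esub>}"
    using hom_in_carrier [OF \<open>q \<in> hom ?P (sum_group J H)\<close> x] H
    by (simp add: carrier_sum_group)
  ultimately show False
    using inj finite_subset range_inj_infinite by blast
qed

end
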